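(* Let $\Phi=\{\phi_i\}_{i\in\mathcal{D}}$ be a rational iterated function system on $\mathbb{R}^d$ satisfying the open set condition, with attractor $X\subset\mathbb{R}^d$. Then $X$ contains very well approximable numbers (points of $\mathbb{R}^d$) that are not Liouville.
   Context: A similarity is a map $\phi:\mathbb{R}^d\to\mathbb{R}^d$ with $|\phi(x)-\phi(y)|=r|x-y|$ for all $x,y\in\mathbb{R}^d$, for some $r\in(0,1)$. An iterated function system (IFS) is a finite set $\Phi=\{\phi_i\}_{i\in\mathcal{D}}$ of contractions (maps $\phi$ with $|\phi(x)-\phi(y)|\le r|x-y|$ for all $x,y$, for some $r\in(0,1)$); its attractor is the unique non-empty compact set $X$ with $X=\bigcup_{i\in\mathcal{D}}\phi_i(X)$. $\Phi$ is a rational IFS if each $\phi_i$ is a similarity of the form $\phi_i(x)=\frac{p_i x}{q_i}+\big(\frac{a_{i,1}}{b_{i,1}},\dots,\frac{a_{i,d}}{b_{i,d}}\big)$ with $p_i,q_i\in\mathbb{Z}$ and $a_{i,1},b_{i,1},\dots,a_{i,d},b_{i,d}\in\mathbb{Z}$. Open set condition: there is a non-empty open set $O\subset\mathbb{R}^d$ with $\phi_i(O)\subset O$ for all $i\in\mathcal{D}$ and $\phi_i(O)\cap\phi_j(O)=\emptyset$ for all $i\ne j$. $\alpha=(\alpha_1,\dots,\alpha_d)\in\mathbb{R}^d$ is very well approximable if there exists $\tau>1+1/d$ for which there exist infinitely many $(p_1/q,\dots,p_d/q)\in\mathbb{Q}^d$ satisfying $$\max_{1\le i\le d}\Big|\alpha_i-\frac{p_i}{q}\Big|\le\frac{1}{q^{\tau}}.$$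 $\alpha$ is Liouville if this holds (for infinitely many such rational points) for all $\tau>1+1/d$.
   Formalization: The iterated function system is assumed to consist of at least two maps; with a single map, such as x/3 on the line, the attractor is one rational point and the claim fails. *)

theory Defs
  imports "HOL-Analysis.Analysis"
begin

definition contraction :: "(real ^ 'n \<Rightarrow> real ^ 'n) \<Rightarrow> bool" where
  "contraction f \<longleftrightarrow>
     (\<exists>r::real. 0 < r \<and> r < 1 \<and> (\<forall>x y. dist (f x) (f y) \<le> r * dist x y))"

text \<open>As in the theory of iterated function systems, a similarity is contracting: the ratio lies
  in the open unit interval.\<close>

definition similarity :: "(real ^ 'n \<Rightarrow> real ^ 'n) \<Rightarrow> bool" where
  "similarity f \<longleftrightarrow>
     (\<exists>r::real. 0 < r \<and> r < 1 \<and> (\<forall>x y. dist (f x) (f y) = r * dist x y))"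

definition ifs :: "'i set \<Rightarrow> ('i \<Rightarrow> real ^ 'n \<Rightarrow> real ^ 'n) \<Rightarrow> bool" where
  "ifs D \<phi> \<longleftrightarrow> finite D \<and> (\<forall>i\<in>D. contraction (\<phi> i))"

definition rational_ifs :: "'i set \<Rightarrow> ('i \<Rightarrow> real ^ 'n \<Rightarrow> real ^ 'n) \<Rightarrow> bool" where
  "rational_ifs D \<phi> \<longleftrightarrow> ifs D \<phi> \<and>
     (\<forall>i\<in>D. similarity (\<phi> i) \<and>
        (\<exists>(p::int) (q::int) (a::int ^ 'n) (b::int ^ 'n).
           q \<noteq> 0 \<and> (\<forall>j. b $ j \<noteq> 0) \<and>
           (\<forall>x. \<phi> i x =
              (of_int p / of_int q) *\<^sub>R x + (\<chi> j. of_int (a $ j) / of_int (b $ j)))))"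

text \<open>For an iterated function system with at least one map, exactly one set satisfies this predicate (Hutchinson).\<close>

definition is_attractor ::
    "'i set \<Rightarrow> ('i \<Rightarrow> real ^ 'n \<Rightarrow> real ^ 'n) \<Rightarrow> (real ^ 'n) set \<Rightarrow> bool" where
  "is_attractor D \<phi> X \<longleftrightarrow> X \<noteq> {} \<and> compact X \<and> X = (\<Union>i\<in>D. \<phi> i ` X)"

definition open_set_condition :: "'i set \<Rightarrow> ('i \<Rightarrow> real ^ 'n \<Rightarrow> real ^ 'n) \<Rightarrow> bool" where
  "open_set_condition D \<phi> \<longleftrightarrow>
     (\<exists>U. open U \<and> U \<noteq> {} \<and> (\<forall>i\<in>D. \<phi> i ` U \<subseteq> U) \<and>
        (\<forall>i\<in>D. \<forall>j\<in>D. i \<noteq> j \<longrightarrow> \<phi> i ` U \<inter> \<phi> j ` U = {}))"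

text \<open>The rational points are collected as points of the space, not as pairs of a numerator vector
  and a denominator, so a point having several suitable representations counts once. The fractions
  need not be in lowest terms.\<close>

definition rational_approximants :: "real ^ 'n \<Rightarrow> real \<Rightarrow> (real ^ 'n) set" where
  "rational_approximants \<alpha> \<tau> =
     {v. \<exists>(p::int ^ 'n) (q::nat). q > 0 \<and> v = (\<chi> i. of_int (p $ i) / of_nat q) \<and>
           (MAX i. \<bar>\<alpha> $ i - of_int (p $ i) / of_nat q\<bar>) \<le> 1 / of_nat q powr \<tau>}"

definition very_well_approximable :: "real ^ 'n \<Rightarrow> bool" where
  "very_well_approximable \<alpha> \<longleftrightarrow>
     (\<exists>\<tau>::real. \<tau> > 1 + 1 / of_nat CARD('n) \<and> infinite (rational_approximants \<alpha> \<tau>))"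

definition liouville :: "real ^ 'n \<Rightarrow> bool" where
  "liouville \<alpha> \<longleftrightarrow>
     (\<forall>\<tau>::real. \<tau> > 1 + 1 / of_nat CARD('n) \<longrightarrow> infinite (rational_approximants \<alpha> \<tau>))"

end

theory Submission
  imports Defs
begin

text \<open>
  Two of the maps, \<open>f\<close> and \<open>g\<close>, suffice. Let \<open>z\<close> be the fixed point of \<open>f\<close>; it is a rational
  point of the attractor \<open>X\<close>. The point sought has a symbolic expansion consisting of long blocks of
  \<open>f\<close> separated by single letters \<open>g\<close>. If \<open>\<psi>\<^sub>k\<close> is the composition of the letters up to the \<open>k\<close>-th \<open>g\<close>,
  then the rational point \<open>v\<^sub>k = \<psi>\<^sub>k z\<close> has a denominator \<open>Q\<^sub>k\<close> that is exponential in the number of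
  letters of \<open>\<psi>\<^sub>k\<close>. Both the limit point \<open>x\<close> and \<open>v\<^sub>k\<close> lie in \<open>\<psi>\<^sub>k (f\<^sup>n X)\<close>, where \<open>n\<close> is the length of
  the block that follows. Taking \<open>n\<close> to be a large constant multiple of the length of \<open>\<psi>\<^sub>k\<close> gives
  \<open>|x - v\<^sub>k| \<le> Q\<^sub>k\<^sup>-\<^sup>3\<close>, and yet \<open>Q\<^sub>k\<^sub>+\<^sub>1\<close> is at most a fixed power of \<open>Q\<^sub>k\<close>.

  The exponent \<open>3\<close> exceeds \<open>1 + 1/d\<close> in every dimension \<open>d\<close>, so \<open>x\<close> is very well approximable
  (\<open>very_well_approximable_of_cubic_approximants\<close>) as soon as the \<open>v\<^sub>k\<close> take infinitely many values. For
  the failure of the Liouville property, compare an arbitrary rational point \<open>w\<close> of denominator \<open>q\<close>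
  with the first \<open>v\<^sub>k\<close> of denominator well beyond \<open>q\<close>: distinct rational points of denominators \<open>q\<close> and
  \<open>Q\<^sub>k\<close> are at least \<open>1/(q Q\<^sub>k)\<close> apart, which is at least twice \<open>|x - v\<^sub>k|\<close>, and \<open>Q\<^sub>k\<close> is at most
  a fixed power of \<open>q\<close> because the denominators grow polynomially
  (\<open>not_liouville_of_well_spaced_approximants\<close>). If \<open>w\<close> happens to equal \<open>v\<^sub>k\<close>, the next approximant
  \<open>v\<^sub>k\<^sub>+\<^sub>1\<close> does the same work.

  Both arguments need consecutive approximants to differ, which amounts to \<open>g z \<noteq> z\<close>. This is what
  the open set condition provides: maps \<open>x \<mapsto> \<kappa> x + s\<close> with a common fixed point commute, and then
  \<open>f (g U) = g (f U)\<close> lies in both \<open>f U\<close> and \<open>g U\<close>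
  (\<open>common_fixpoint_violates_disjointness\<close>).
\<close>

section \<open>Rational points and their denominators\<close>

lemma finite_rationals_common_denominator:
  fixes S :: "real set"
  assumes "finite S" "S \<subseteq> \<rat>"
  shows "\<exists>M::nat. M \<ge> 2 \<and> (\<forall>s\<in>S. real M * s \<in> \<int>)"
  using assms
proof (induction S rule: finite_induct)
  case empty
  then show ?case by auto
next
  case (insert a S)
  then obtain M :: nat where M: "M \<ge> 2" "\<forall>s\<in>S. real M * s \<in> \<int>"
    by auto
  have "a \<in> \<rat>" using insert.prems by auto
  then obtain p r :: int where "r > 0" "a = of_int p / of_int r"
    by (elim Rats_cases')
  then obtain q :: nat where pq: "q > 0" "a = of_int p / of_nat q"
    by (metis of_int_of_nat_eq zero_less_imp_eq_int)
  have "M * q \<ge> 2"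
    using mult_le_mono[of 2 M 1 q] M(1) pq(1) by simp
  moreover have "real (M * q) * s \<in> \<int>" if "s \<in> insert a S" for s
  proof (cases "s = a")
    case True
    then have "real (M * q) * s = of_int (int M * p)"
      using pq by simp
    then show ?thesis by (metis Ints_of_int)
  next
    case False
    then have "real M * s \<in> \<int>" using that M by auto
    then have "real q * (real M * s) \<in> \<int>" using Ints_mult[OF Ints_of_nat] by blast
    then show ?thesis by (simp add: mult_ac)
  qed
  ultimately show ?case by blast
qed

lemma finite_vectors_over_finite_set:
  fixes S :: "'a set"
  assumes "finite S"
  shows "finite {v :: 'a ^ 'n. \<forall>i. v $ i \<in> S}"
proof -
  have "finite (PiE (UNIV :: 'n set) (\<lambda>_. S))"
    using assms by (intro finite_PiE) auto
  moreover have "vec_nth ` {v :: 'a ^ 'n. \<forall>i. v $ i \<in> S} \<subseteq> PiE UNIV (\<lambda>_. S)"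
    by auto
  ultimately have "finite (vec_nth ` {v :: 'a ^ 'n. \<forall>i. v $ i \<in> S})"
    by (rule finite_subset[rotated])
  then show ?thesis
    by (rule finite_imageD) (auto simp: inj_on_def vec_eq_iff)
qed

text \<open>Approximants stay within distance \<open>1\<close> of the point, so to show that they are finite in number it
  is enough to bound their denominators.\<close>

lemma finite_bounded_denominator:
  fixes x :: "real ^ 'n" and B :: nat
  shows "finite {v. \<exists>(p::int ^ 'n) (q::nat). q > 0 \<and> q \<le> B \<and>
           v = (\<chi> i. of_int (p $ i) / of_nat q) \<and> (\<forall>i. \<bar>x $ i - v $ i\<bar> \<le> 1)}"
    (is "finite ?A")
proof -
  define N where "N = \<lceil>real B * (norm x + 1)\<rceil>"
  define S where "S = (\<lambda>(a, q). real_of_int a / real q) ` ({-N..N} \<times> {..B})"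
  have "v $ i \<in> S" if mem: "v \<in> ?A" for v i
  proof -
    obtain p :: "int ^ 'n" and q :: nat where pq: "q > 0" "q \<le> B"
      "v = (\<chi> i. of_int (p $ i) / of_nat q)" "\<forall>i. \<bar>x $ i - v $ i\<bar> \<le> 1"
      using mem unfolding mem_Collect_eq by (elim exE conjE)
    have "\<bar>v $ i\<bar> \<le> norm x + 1"
      using pq(4)[rule_format, of i] component_le_norm_cart[of x i] by linarith
    moreover have "\<bar>real_of_int (p $ i)\<bar> = real q * \<bar>v $ i\<bar>"
      using pq by (simp add: abs_divide)
    ultimately have "\<bar>real_of_int (p $ i)\<bar> \<le> real B * (norm x + 1)"
      using pq(2) by (simp add: mult_mono)
    then have "\<bar>p $ i\<bar> \<le> N"
      unfolding N_def by linarith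
    then have "(p $ i, q) \<in> {-N..N} \<times> {..B}"
      using pq by auto
    then show ?thesis
      unfolding S_def using pq(3) by force
  qed
  then have "?A \<subseteq> {v. \<forall>i. v $ i \<in> S}" by blast
  moreover have "finite S" unfolding S_def by simp
  ultimately show ?thesis
    using finite_vectors_over_finite_set finite_subset by blast
qed

lemma max_component_le_iff:
  fixes h :: "'n::finite \<Rightarrow> real"
  shows "(MAX i. h i) \<le> c \<longleftrightarrow> (\<forall>i. h i \<le> c)"
  by (subst Max_le_iff) auto

lemma rational_separation:
  fixes a b :: real and q Q :: nat
  assumes "real q * a \<in> \<int>" "real Q * b \<in> \<int>" "a \<noteq> b" "q > 0" "Q > 0"
  shows "1 / (real q * real Q) \<le> \<bar>a - b\<bar>"
proof -
  have "real Q * (real q * a) - real q * (real Q * b) \<in> \<int>"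
    using Ints_mult[OF Ints_of_nat assms(1)] Ints_mult[OF Ints_of_nat assms(2)]
    by (rule Ints_diff)
  moreover have eq: "real Q * (real q * a) - real q * (real Q * b) = real q * real Q * (a - b)"
    by (simp add: algebra_simps)
  ultimately have "\<bar>real q * real Q * (a - b)\<bar> \<ge> 1"
    using assms by (intro Ints_nonzero_abs_ge1) auto
  then have "1 \<le> \<bar>a - b\<bar> * (real q * real Q)"
    by (simp add: abs_mult mult_ac)
  then show ?thesis
    using assms by (simp add: pos_divide_le_eq)
qed

text \<open>A convergent sequence of finitely many values is eventually constant.\<close>

lemma infinite_range_of_convergent:
  fixes v :: "nat \<Rightarrow> 'a::t1_space"
  assumes "v \<longlonglongrightarrow> x" "\<And>k. v k \<noteq> v (Suc k)"
  shows "infinite (range v)"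
proof
  assume "finite (range v)"
  then have "open (- (range v - {x}))"
    by (intro open_Compl finite_imp_closed) auto
  with assms(1) have "eventually (\<lambda>k. v k \<in> - (range v - {x})) sequentially"
    by (rule topological_tendstoD) auto
  then have "eventually (\<lambda>k. v k = x) sequentially"
    by (rule eventually_mono) auto
  then obtain N where "\<And>k. k \<ge> N \<Longrightarrow> v k = x"
    by (auto simp: eventually_sequentially)
  then show False
    using assms(2)[of N] by (metis le_SucI order_refl)
qed

section \<open>Diophantine consequences of a sequence of good approximants\<close>

text \<open>Choosing \<open>k\<close> minimal with \<open>Q k \<ge> 2 (Q 0) q\<close> makes the distance from \<open>x\<close> to \<open>v k\<close> at most half of the
  gap between \<open>v k\<close> and any other point of denominator \<open>q\<close>, and minimality bounds \<open>Q k\<close> by a power of \<open>q\<close>. The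
  exponent is \<open>C * C\<close> instead of \<open>C\<close> to leave room for moving on to \<open>v (Suc k)\<close> when \<open>w = v k\<close>.\<close>

lemma irrationality_bound_of_well_spaced_approximants:
  fixes x :: "real ^ 'n" and v :: "nat \<Rightarrow> real ^ 'n" and Q :: "nat \<Rightarrow> nat"
  assumes mono: "strict_mono Q" and pos: "Q 0 > 0"
    and growth: "\<And>k. Q (Suc k) \<le> Q k ^ C"
    and int: "\<And>k i. real (Q k) * v k $ i \<in> \<int>"
    and neq: "\<And>k. v k \<noteq> v (Suc k)"
    and close: "\<And>k. dist x (v k) \<le> 1 / real (Q k) ^ 3"
    and q: "q > 0" and w: "\<And>i. real q * w $ i \<in> \<int>"
  shows "\<exists>i. 1 / (2 * real q * (2 * real (Q 0) * real q) ^ (C * C)) \<le> \<bar>x $ i - w $ i\<bar>"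
proof -
  have Qpos: "Q k > 0" for k
    using pos mono by (metis less_le_trans le0 strict_mono_less_eq)
  \<comment> \<open>The factor \<open>Q 0\<close> forces \<open>k > 0\<close> below, so that \<open>Q k\<close> has a predecessor \<open>Q j < R\<close>.\<close>
  define R where "R = 2 * Q 0 * q"
  define k where "k = (LEAST k. R \<le> Q k)"
  have "R \<le> Q R"
    using mono by (rule strict_mono_imp_increasing)
  then have k: "R \<le> Q k"
    unfolding k_def by (rule LeastI)
  have "Q 0 < R"
    using pos q by (simp add: R_def) 
  then have "k \<noteq> 0" using k by (metis not_less)
  then obtain j where j: "k = Suc j" by (cases k) auto
  have "\<not> R \<le> Q j"
    using not_less_Least[of j "\<lambda>k. R \<le> Q k"] j by (simp add: k_def)
  then have Qj: "Q j \<le> R" by simp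
  have kR: "Q k \<le> R ^ C"
    using growth[of j] Qj j by (meson le_trans power_mono zero_le)
  have SkR: "Q (Suc k) \<le> R ^ (C * C)"
    using growth[of k] kR by (metis le_trans power_mono zero_le power_mult)
  have "Q k \<le> Q (Suc k)" using mono by (simp add: strict_mono_less_eq)
  \<comment> \<open>At least one of two consecutive approximants differs from \<open>w\<close>.\<close>
  obtain l where l: "v l \<noteq> w" "k \<le> l" "Q l \<le> R ^ (C * C)"
    using neq[of k] SkR \<open>Q k \<le> Q (Suc k)\<close>
    by (metis le_refl le_SucI le_trans)
  have "R \<le> Q l" using k l(2) mono by (meson le_trans strict_mono_less_eq)
  obtain i where i: "w $ i \<noteq> v l $ i" using l(1) by (metis vec_eq_iff)
  have sep: "1 / (real q * real (Q l)) \<le> \<bar>w $ i - v l $ i\<bar>"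
    using w int i q Qpos by (intro rational_separation) auto
  have "2 * q \<le> R" using pos by (simp add: R_def)
  then have "2 * real q \<le> real (Q l)" using \<open>R \<le> Q l\<close> by linarith
  moreover have Q1: "real (Q l) \<ge> 1" using Qpos[of l] by linarith
  ultimately have "2 * real q * real (Q l) \<le> real (Q l) * real (Q l) * real (Q l)"
    by (smt (verit) mult_mono mult_nonneg_nonneg mult_right_mono mult_cancel_left1 of_nat_0_le_iff)
  then have "1 / real (Q l) ^ 3 \<le> 1 / (2 * real q * real (Q l))"
    using q Qpos[of l] by (intro divide_left_mono) (auto simp: power3_eq_cube)
  moreover have "\<bar>x $ i - v l $ i\<bar> \<le> dist x (v l)"
    by (metis component_le_norm_cart dist_norm vector_minus_component)
  ultimately have near: "\<bar>x $ i - v l $ i\<bar> \<le> 1 / (2 * real q * real (Q l))"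
    using close[of l] by linarith
  have "1 / (2 * real q * (2 * real (Q 0) * real q) ^ (C * C)) \<le> 1 / (2 * real q * real (Q l))"
  proof (rule divide_left_mono)
    have "real (Q l) \<le> real (R ^ (C * C))" using l(3) by (simp only: of_nat_le_iff)
    then have "real (Q l) \<le> (2 * real (Q 0) * real q) ^ (C * C)"
      by (simp add: R_def)
    then show "2 * real q * real (Q l) \<le> 2 * real q * (2 * real (Q 0) * real q) ^ (C * C)"
      by (intro mult_left_mono) auto
  qed (use q Qpos pos in auto)
  also have "\<dots> = 1 / (real q * real (Q l)) - 1 / (2 * real q * real (Q l))"
    using q Qpos[of l] by (simp add: field_simps)
  also have "\<dots> \<le> \<bar>w $ i - v l $ i\<bar> - \<bar>x $ i - v l $ i\<bar>"
    using sep near by (rule diff_mono)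
  also have "\<dots> \<le> \<bar>x $ i - w $ i\<bar>"
    by linarith
  finally show ?thesis by blast
qed

text \<open>The lower bound above is of order \<open>q ^ -(E + 1)\<close> with \<open>E = C * C\<close>. At exponent \<open>E + 3\<close> it rules out
  all approximants with \<open>q\<^sup>2 > B\<close>, where \<open>1 / B\<close> is its constant.\<close>

lemma not_liouville_of_well_spaced_approximants:
  fixes x :: "real ^ 'n" and v :: "nat \<Rightarrow> real ^ 'n" and Q :: "nat \<Rightarrow> nat"
  assumes mono: "strict_mono Q" and pos: "Q 0 > 0"
    and growth: "\<And>k. Q (Suc k) \<le> Q k ^ C"
    and int: "\<And>k i. real (Q k) * v k $ i \<in> \<int>"
    and neq: "\<And>k. v k \<noteq> v (Suc k)"
    and close: "\<And>k. dist x (v k) \<le> 1 / real (Q k) ^ 3"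
  shows "\<not> liouville x"
proof -
  define E where "E = C * C"
  define B where "B = 2 * (2 * Q 0) ^ E"
  define \<tau> where "\<tau> = real (E + 3)"
  have "rational_approximants x \<tau> \<subseteq> {v. \<exists>(p::int ^ 'n) (q::nat). q > 0 \<and> q \<le> B \<and>
           v = (\<chi> i. of_int (p $ i) / of_nat q) \<and> (\<forall>i. \<bar>x $ i - v $ i\<bar> \<le> 1)}"
  proof (rule subsetI, rule CollectI)
    fix w assume "w \<in> rational_approximants x \<tau>"
    then obtain p :: "int ^ 'n" and q :: nat where pq: "q > 0"
      "w = (\<chi> i. of_int (p $ i) / of_nat q)" and
      "(MAX i. \<bar>x $ i - of_int (p $ i) / of_nat q\<bar>) \<le> 1 / of_nat q powr \<tau>"
      unfolding rational_approximants_def by auto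
    moreover have "real q powr \<tau> = real q ^ (E + 3)"
      using pq(1) unfolding \<tau>_def by (subst powr_realpow) auto
    ultimately have ub: "\<bar>x $ i - w $ i\<bar> \<le> 1 / real q ^ (E + 3)" for i
      by (simp add: max_component_le_iff)
    have q1: "real q \<ge> 1" using pq(1) by linarith
    have "\<bar>x $ i - w $ i\<bar> \<le> 1" for i
    proof -
      have "1 / real q ^ (E + 3) \<le> 1"
        using q1 by (simp add: divide_le_eq one_le_power del: power_Suc)
      with ub[of i] show ?thesis by linarith
    qed
    moreover have "q \<le> B"
    proof -
      have "real q * w $ i \<in> \<int>" for i using pq by simp
      with irrationality_bound_of_well_spaced_approximants[where Q = Q and v = v, OF mono pos growth int neq close pq(1)]
      obtain i where "1 / (2 * real q * (2 * real (Q 0) * real q) ^ E) \<le> \<bar>x $ i - w $ i\<bar>"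
        unfolding E_def by blast
      then have "1 / (2 * real q * (2 * real (Q 0) * real q) ^ E) \<le> 1 / real q ^ (E + 3)"
        using ub[of i] by linarith
      then have "real q ^ (E + 3) \<le> 2 * real q * (2 * real (Q 0) * real q) ^ E"
        using pq(1) pos by (simp add: field_simps)
      then have "real q ^ (E + 1) * (real q * real q) \<le> real q ^ (E + 1) * real B"
        by (simp add: B_def power_mult_distrib power_add power3_eq_cube mult_ac)
      then have "real q * real q \<le> real B"
        using pq(1) by (subst (asm) mult_le_cancel_left_pos) auto
      moreover have "real q * 1 \<le> real q * real q" using q1 by (intro mult_left_mono) auto
      ultimately have "real q \<le> real B" by linarith
      then show ?thesis by simp
    qed
    ultimately show "\<exists>(p::int ^ 'n) (q::nat). q > 0 \<and> q \<le> B \<and>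
           w = (\<chi> i. of_int (p $ i) / of_nat q) \<and> (\<forall>i. \<bar>x $ i - w $ i\<bar> \<le> 1)"
      using pq by blast
  qed
  then have "finite (rational_approximants x \<tau>)"
    using finite_bounded_denominator finite_subset by blast
  moreover have "1 + 1 / real CARD('n) < \<tau>"
  proof -
    have "1 / real CARD('n) \<le> 1" by (simp add: Suc_leI)
    then show ?thesis unfolding \<tau>_def by linarith
  qed
  ultimately show ?thesis unfolding liouville_def by blast
qed

text \<open>The assumption that consecutive approximants differ makes the set of approximants infinite even
  if \<open>x\<close> is itself one of them.\<close>

lemma very_well_approximable_of_cubic_approximants:
  fixes x :: "real ^ 'n" and v :: "nat \<Rightarrow> real ^ 'n" and Q :: "nat \<Rightarrow> nat"
  assumes mono: "strict_mono Q" and pos: "Q 0 > 0"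
    and int: "\<And>k i. real (Q k) * v k $ i \<in> \<int>"
    and neq: "\<And>k. v k \<noteq> v (Suc k)"
    and close: "\<And>k. dist x (v k) \<le> 1 / real (Q k) ^ 3"
  shows "very_well_approximable x"
proof -
  have Qpos: "Q k > 0" for k
    using pos mono by (metis less_le_trans le0 strict_mono_less_eq)
  have "v k \<in> rational_approximants x 3" for k
  proof -
    have "\<forall>i. \<exists>a::int. real (Q k) * v k $ i = of_int a"
      using int[of k] by (metis Ints_cases)
    then obtain a :: "'n \<Rightarrow> int" where a: "\<And>i. real (Q k) * v k $ i = of_int (a i)"
      by metis
    define p :: "int ^ 'n" where "p = (\<chi> i. a i)"
    have v: "v k = (\<chi> i. of_int (p $ i) / of_nat (Q k))"
      using a Qpos[of k] by (simp add: p_def vec_eq_iff field_simps)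
    have "\<bar>x $ i - v k $ i\<bar> \<le> 1 / real (Q k) ^ 3" for i
      using close[of k] component_le_norm_cart[of "x - v k" i] by (simp add: dist_norm)
    moreover have "real (Q k) powr 3 = real (Q k) ^ 3"
      using Qpos[of k] by simp
    ultimately have "(MAX i. \<bar>x $ i - of_int (p $ i) / of_nat (Q k)\<bar>) \<le> 1 / of_nat (Q k) powr 3"
      by (simp add: max_component_le_iff v)
    then show ?thesis
      unfolding rational_approximants_def using v Qpos[of k] by blast
  qed
  moreover have "infinite (range v)"
  proof (rule infinite_range_of_convergent[where v = v, OF _ neq])
    have "dist (v k) x \<le> inverse (real k)" if "k \<ge> 1" for k
    proof -
      have "real k \<le> real (Q k)"
        using strict_mono_imp_increasing[OF mono] by simp
      also have "\<dots> \<le> real (Q k) ^ 3"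
        using Qpos[of k] by (intro self_le_power) auto
      finally have "1 / real (Q k) ^ 3 \<le> inverse (real k)"
        using that Qpos[of k] by (simp add: field_simps)
      then show ?thesis using close[of k] by (simp add: dist_commute)
    qed
    then have "eventually (\<lambda>k. norm (dist (v k) x) \<le> inverse (real k)) sequentially"
      by (auto simp: eventually_sequentially)
    then have "(\<lambda>k. dist (v k) x) \<longlonglongrightarrow> 0"
      by (rule Lim_null_comparison[OF _ lim_inverse_n])
    then show "v \<longlonglongrightarrow> x" by (rule tendsto_dist_iff[THEN iffD2])
  qed
  ultimately have "infinite (rational_approximants x 3)"
    by (meson finite_subset image_subsetI)
  moreover have "1 + 1 / real CARD('n) < 3"
  proof -
    have "1 / real CARD('n) \<le> 1" by (simp add: Suc_leI)
    then show ?thesis by linarith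
  qed
  ultimately show ?thesis unfolding very_well_approximable_def by blast
qed

section \<open>Words with long blocks of one letter\<close>

text \<open>The number of letters of \<open>prefix_map K f g k\<close>. A block has length \<open>K\<close> times one more than the
  number of letters before it, because evaluating a word of \<open>l\<close> letters at \<open>z\<close> yields the
  denominator \<open>M ^ (l + 1)\<close>, the additional factor \<open>M\<close> coming from \<open>z\<close> itself.\<close>

primrec prefix_length :: "nat \<Rightarrow> nat \<Rightarrow> nat" where
  "prefix_length K 0 = 0"
| "prefix_length K (Suc k) = prefix_length K k + K * (prefix_length K k + 1) + 1"

primrec prefix_map :: "nat \<Rightarrow> ('a \<Rightarrow> 'a) \<Rightarrow> ('a \<Rightarrow> 'a) \<Rightarrow> nat \<Rightarrow> 'a \<Rightarrow> 'a" where
  "prefix_map K f g 0 = id"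
| "prefix_map K f g (Suc k) = prefix_map K f g k \<circ> (f ^^ (K * (prefix_length K k + 1))) \<circ> g"

lemma inj_prefix_map:
  assumes "inj f" "inj g"
  shows "inj (prefix_map K f g k)"
  using assms by (induction k) (auto intro!: inj_compose inj_fn)

lemma dist_funpow_le:
  fixes f :: "'a::metric_space \<Rightarrow> 'a"
  assumes "0 \<le> r" "\<And>x y. dist (f x) (f y) \<le> r * dist x y"
  shows "dist ((f ^^ n) x) ((f ^^ n) y) \<le> r ^ n * dist x y"
proof (induction n)
  case (Suc n)
  have "dist ((f ^^ Suc n) x) ((f ^^ Suc n) y) \<le> r * dist ((f ^^ n) x) ((f ^^ n) y)"
    using assms(2) by simp
  also have "\<dots> \<le> r * (r ^ n * dist x y)"
    using Suc assms(1) by (intro mult_left_mono)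
  finally show ?case by (simp add: mult_ac)
qed simp

lemma dist_prefix_map_le:
  fixes f :: "'a::metric_space \<Rightarrow> 'a"
  assumes f: "\<And>x y. dist (f x) (f y) \<le> dist x y"
    and g: "\<And>x y. dist (g x) (g y) \<le> dist x y"
  shows "dist (prefix_map K f g k x) (prefix_map K f g k y) \<le> dist x y"
proof (induction k arbitrary: x y)
  case (Suc k)
  let ?h = "f ^^ (K * (prefix_length K k + 1))"
  have "dist (?h (g x)) (?h (g y)) \<le> 1 ^ (K * (prefix_length K k + 1)) * dist (g x) (g y)"
    by (rule dist_funpow_le) (use f in auto)
  then show ?case
    using Suc[of "?h (g x)" "?h (g y)"] g[of x y] by simp
qed simp

definition integral_at :: "nat \<Rightarrow> nat \<Rightarrow> real ^ 'n \<Rightarrow> bool" where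
  "integral_at M e v \<longleftrightarrow> (\<forall>i. real M ^ e * v $ i \<in> \<int>)"

lemma integral_at_affine:
  assumes "real M * \<kappa> \<in> \<int>" "\<And>i. real M * s $ i \<in> \<int>" "integral_at M e v"
  shows "integral_at M (e + 1) (\<kappa> *\<^sub>R v + s)"
  unfolding integral_at_def
proof
  fix i
  have v: "real M ^ e * v $ i \<in> \<int>"
    using assms(3) by (auto simp: integral_at_def)
  have "(real M * \<kappa>) * (real M ^ e * v $ i) + real M ^ e * (real M * s $ i) \<in> \<int>"
    using Ints_mult[OF assms(1) v] Ints_mult[OF Ints_power[OF Ints_of_nat] assms(2)]
    by (rule Ints_add)
  then show "real M ^ (e + 1) * (\<kappa> *\<^sub>R v + s) $ i \<in> \<int>"
    by (simp add: algebra_simps)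
qed

lemma integral_at_prefix_map:
  assumes f: "\<And>e v. integral_at M e v \<Longrightarrow> integral_at M (e + 1) (f v)"
    and g: "\<And>e v. integral_at M e v \<Longrightarrow> integral_at M (e + 1) (g v)"
    and v: "integral_at M e v"
  shows "integral_at M (e + prefix_length K k) (prefix_map K f g k v)"
  using v
proof (induction k arbitrary: e v)
  case (Suc k)
  have iter: "integral_at M (e + n) ((f ^^ n) v)" if "integral_at M e v" for n e v
    using that by (induction n) (use f in fastforce)+
  let ?n = "K * (prefix_length K k + 1)"
  have "integral_at M (e + 1 + ?n + prefix_length K k) (prefix_map K f g k ((f ^^ ?n) (g v)))"
    using Suc g iter by blast
  then show ?case by (simp add: ac_simps)
qed simp

section \<open>The point of the attractor\<close>

text \<open>Homotheties with the same centre commute.\<close>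

lemma common_fixpoint_violates_disjointness:
  fixes f g :: "'a::real_vector \<Rightarrow> 'a"
  assumes f: "\<And>x. f x = \<kappa> *\<^sub>R x + s" and g: "\<And>x. g x = \<mu> *\<^sub>R x + t"
    and "f z = z" "g z = z"
    and "f ` U \<subseteq> U" "g ` U \<subseteq> U" "U \<noteq> {}"
  shows "f ` U \<inter> g ` U \<noteq> {}"
proof -
  have s: "s = z - \<kappa> *\<^sub>R z" and t: "t = z - \<mu> *\<^sub>R z"
    using f[of z] g[of z] assms(3,4) by (simp_all add: algebra_simps)
  have comm: "f (g x) = g (f x)" for x
    by (simp add: f g s t algebra_simps)
  obtain u where "u \<in> U" using assms by auto
  then have "f (g u) \<in> f ` U" "g (f u) \<in> g ` U"
    using assms by auto
  then show ?thesis using comm by (metis disjoint_iff)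
qed

text \<open>The point is found in the intersection of the nested compact sets \<open>(\<psi> k \<circ> (f ^^ n k)) ` X\<close>. Each of them also
  contains \<open>v k\<close>, because \<open>z\<close> is fixed by \<open>f\<close>; hence its diameter bounds the distance of \<open>x\<close> to \<open>v k\<close>.\<close>

lemma rational_similarity_pair_attractor:
  fixes f g :: "real ^ 'n \<Rightarrow> real ^ 'n"
  assumes f: "\<And>x. f x = \<kappa> *\<^sub>R x + s" and g: "\<And>x. g x = \<mu> *\<^sub>R x + t"
    and lam: "0 < \<bar>\<kappa>\<bar>" "\<bar>\<kappa>\<bar> < 1" and mu: "0 < \<bar>\<mu>\<bar>" "\<bar>\<mu>\<bar> < 1"
    and rat: "\<kappa> \<in> \<rat>" "\<mu> \<in> \<rat>" "\<And>i. s $ i \<in> \<rat>" "\<And>i. t $ i \<in> \<rat>"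
    and X: "compact X" "X \<noteq> {}" "f ` X \<subseteq> X" "g ` X \<subseteq> X"
    and no_common: "\<And>z. f z = z \<Longrightarrow> g z \<noteq> z"
  shows "\<exists>x\<in>X. very_well_approximable x \<and> \<not> liouville x"
proof -
  have df: "dist (f x) (f y) = \<bar>\<kappa>\<bar> * dist x y" for x y
    by (simp add: f dist_norm flip: scaleR_diff_right)
  have dg: "dist (g x) (g y) = \<bar>\<mu>\<bar> * dist x y" for x y
    by (simp add: g dist_norm flip: scaleR_diff_right)
  have "\<exists>!z. z \<in> X \<and> f z = z"
    using X lam df
    by (intro Banach_fix[of X "\<bar>\<kappa>\<bar>"]) (auto simp: compact_imp_complete)
  then obtain z where z: "z \<in> X" "f z = z" by blast
  have gz: "g z \<noteq> z" using no_common z(2) .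
  have z_rat: "z $ i \<in> \<rat>" for i
  proof -
    have "z $ i = \<kappa> * z $ i + s $ i"
      using z(2) f[of z] by (metis vector_add_component vector_scaleR_component real_scaleR_def)
    then have "z $ i = s $ i / (1 - \<kappa>)"
      using lam by (simp add: field_simps)
    then show ?thesis using rat by simp
  qed
  have "finite ({\<kappa>, \<mu>} \<union> range (($) s) \<union> range (($) t) \<union> range (($) z))"
    by simp
  moreover have "{\<kappa>, \<mu>} \<union> range (($) s) \<union> range (($) t) \<union> range (($) z) \<subseteq> \<rat>"
    using rat z_rat by auto
  ultimately obtain M :: nat where M: "M \<ge> 2"
    "\<forall>a \<in> {\<kappa>, \<mu>} \<union> range (($) s) \<union> range (($) t) \<union> range (($) z). real M * a \<in> \<int>"
    using finite_rationals_common_denominator by meson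
  have int_f: "integral_at M (e + 1) (f v)" if "integral_at M e v" for e v
    unfolding f using that M by (intro integral_at_affine) auto
  have int_g: "integral_at M (e + 1) (g v)" if "integral_at M e v" for e v
    unfolding g using that M by (intro integral_at_affine) auto
  have int_z: "integral_at M 1 z"
    using M by (auto simp: integral_at_def)
  \<comment> \<open>\<open>K\<close> letters \<open>f\<close> contract by more than \<open>M ^ 3\<close>, the cube of the denominator that one letter costs; the
    factor \<open>D + 1 \<ge> 1\<close> absorbs the diameter, which enters every estimate once.\<close>
  define D where "D = diameter X"
  have D: "D \<ge> 0" unfolding D_def using X by (simp add: diameter_ge_0 compact_imp_bounded)
  have "0 < 1 / (real M ^ 3 * (D + 1))" using M D by simp
  then obtain K where K: "\<bar>\<kappa>\<bar> ^ K < 1 / (real M ^ 3 * (D + 1))"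
    using real_arch_pow_inv lam by blast
  define len where "len = prefix_length K"
  define n where "n k = K * (len k + 1)" for k
  define \<psi> where "\<psi> = prefix_map K f g"
  define v where "v k = \<psi> k z" for k
  define Q where "Q k = M ^ (len k + 1)" for k
  define F where "F k = (\<psi> k \<circ> (f ^^ n k)) ` X" for k
  have \<psi>_Suc: "\<psi> (Suc k) = \<psi> k \<circ> (f ^^ n k) \<circ> g" for k
    by (simp add: \<psi>_def n_def len_def)
  have fX: "(f ^^ m) ` X \<subseteq> X" for m
    using X(3) by (induction m) auto
  have fz: "(f ^^ m) z = z" for m
    using z(2) by (induction m) auto
  have contr: "dist ((\<psi> k \<circ> (f ^^ n k)) x) ((\<psi> k \<circ> (f ^^ n k)) y) \<le> \<bar>\<kappa>\<bar> ^ n k * dist x y" for k x y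
  proof -
    have "dist ((\<psi> k \<circ> (f ^^ n k)) x) ((\<psi> k \<circ> (f ^^ n k)) y) \<le> dist ((f ^^ n k) x) ((f ^^ n k) y)"
      unfolding \<psi>_def o_apply using lam mu
      by (intro dist_prefix_map_le) (auto simp: df dg mult_left_le_one_le)
    also have "\<dots> \<le> \<bar>\<kappa>\<bar> ^ n k * dist x y"
      by (rule dist_funpow_le) (auto simp: df)
    finally show ?thesis .
  qed
  have "F (Suc k) \<subseteq> F k" for k
    using X(4) fX[of "n (Suc k)"] unfolding F_def \<psi>_Suc by (fastforce simp: image_subset_iff)
  then have F_mono: "F k \<subseteq> F j" if "j \<le> k" for j k
    using that lift_Suc_antimono_le by blast
  have F_compact: "compact (F k)" for k
    unfolding F_def
  proof (rule compact_continuous_image[OF _ X(1)])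
    have "(\<bar>\<kappa>\<bar> ^ n k)-lipschitz_on X (\<psi> k \<circ> (f ^^ n k))"
      using contr by (intro lipschitz_onI) auto
    then show "continuous_on X (\<psi> k \<circ> (f ^^ n k))"
      by (rule lipschitz_on_continuous_on)
  qed
  have "\<Inter> (range F) \<noteq> {}"
    using F_compact X(2) F_mono by (intro compact_nest) (auto simp: F_def)
  then obtain x where x: "\<And>k. x \<in> F k" by auto
  have "x \<in> X"
    using x[of 0] fX[of "n 0"] by (auto simp: F_def \<psi>_def image_subset_iff)
  have close: "dist x (v k) \<le> 1 / real (Q k) ^ 3" for k
  proof -
    obtain y where y: "y \<in> X" "x = (\<psi> k \<circ> (f ^^ n k)) y"
      using x[of k] by (auto simp: F_def)
    have "v k = (\<psi> k \<circ> (f ^^ n k)) z" by (simp add: v_def fz)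
    then have "dist x (v k) \<le> \<bar>\<kappa>\<bar> ^ n k * dist y z"
      using contr y by simp
    also have "\<dots> \<le> \<bar>\<kappa>\<bar> ^ n k * (D + 1) ^ (len k + 1)"
    proof (rule mult_left_mono)
      have "dist y z \<le> D"
        unfolding D_def using y z X by (simp add: diameter_bounded_bound compact_imp_bounded)
      also have "\<dots> \<le> D + 1" by simp
      also have "\<dots> \<le> (D + 1) ^ (len k + 1)" using D by (intro self_le_power) auto
      finally show "dist y z \<le> (D + 1) ^ (len k + 1)" .
    qed simp
    also have "\<dots> = (\<bar>\<kappa>\<bar> ^ K * (D + 1)) ^ (len k + 1)"
      unfolding n_def power_mult power_mult_distrib by simp
    also have "\<dots> \<le> (1 / real M ^ 3) ^ (len k + 1)"
    proof (rule power_mono)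
      have "\<bar>\<kappa>\<bar> ^ K * (D + 1) \<le> 1 / (real M ^ 3 * (D + 1)) * (D + 1)"
        using K D by (intro mult_right_mono) auto
      then show "\<bar>\<kappa>\<bar> ^ K * (D + 1) \<le> 1 / real M ^ 3"
        using D by simp
    qed (use D in auto)
    also have "\<dots> = 1 / real (Q k) ^ 3"
    proof -
      have "(real M ^ 3) ^ (len k + 1) = (real M ^ (len k + 1)) ^ 3"
        by (metis power_mult mult.commute)
      then show ?thesis
        unfolding Q_def power_one_over of_nat_power by (rule arg_cong)
    qed
    finally show ?thesis .
  qed
  have neq: "v k \<noteq> v (Suc k)" for k
  proof
    assume "v k = v (Suc k)"
    then have "\<psi> k ((f ^^ n k) z) = \<psi> k ((f ^^ n k) (g z))"
      by (simp add: v_def \<psi>_Suc fz)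
    moreover have "inj f" "inj g"
      using lam mu by (auto simp: inj_on_def f g)
    then have "inj (\<psi> k)" "inj (f ^^ n k)"
      unfolding \<psi>_def by (auto intro: inj_prefix_map inj_fn)
    ultimately show False using gz by (metis injD)
  qed
  have int_v: "real (Q k) * v k $ i \<in> \<int>" for k i
    using integral_at_prefix_map[OF int_f int_g int_z, where K = K and k = k]
    by (simp add: integral_at_def Q_def v_def \<psi>_def len_def)
  have mono: "strict_mono Q"
    unfolding strict_mono_Suc_iff Q_def
  proof
    show "M ^ (len k + 1) < M ^ (len (Suc k) + 1)" for k
      using M(1) by (intro power_strict_increasing) (simp_all add: len_def)
  qed
  have pos: "Q 0 > 0" using M by (simp add: Q_def)
  have growth: "Q (Suc k) \<le> Q k ^ (K + 2)" for k
  proof -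
    have "Q (Suc k) \<le> M ^ ((len k + 1) * (K + 2))"
      unfolding Q_def using M(1) by (intro power_increasing) (auto simp: len_def algebra_simps)
    then show ?thesis unfolding Q_def power_mult .
  qed
  show ?thesis
    using \<open>x \<in> X\<close> very_well_approximable_of_cubic_approximants[where Q = Q and v = v, OF mono pos int_v neq close]
      not_liouville_of_well_spaced_approximants[where Q = Q and v = v, OF mono pos growth int_v neq close] by blast
qed

text \<open>The similarity ratio of \<open>\<phi> i\<close> is the absolute value of its rational coefficient, which
  is therefore nonzero and of modulus less than \<open>1\<close>.\<close>

lemma rational_ifs_map:
  fixes \<phi> :: "'i \<Rightarrow> real ^ 'n \<Rightarrow> real ^ 'n"
  assumes "rational_ifs D \<phi>" "i \<in> D"
  obtains \<kappa> s where "\<And>x. \<phi> i x = \<kappa> *\<^sub>R x + s" "0 < \<bar>\<kappa>\<bar>" "\<bar>\<kappa>\<bar> < 1" "\<kappa> \<in> \<rat>" "\<And>j. s $ j \<in> \<rat>"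
proof -
  obtain p q :: int and a b :: "int ^ 'n" where
    eq: "\<And>x. \<phi> i x = (of_int p / of_int q) *\<^sub>R x + (\<chi> j. of_int (a $ j) / of_int (b $ j))"
    using assms unfolding rational_ifs_def by blast
  obtain r where r: "0 < r" "r < 1" "\<And>x y. dist (\<phi> i x) (\<phi> i y) = r * dist x y"
    using assms unfolding rational_ifs_def similarity_def by blast
  define \<kappa> :: real where "\<kappa> = of_int p / of_int q"
  obtain e :: "real ^ 'n" where e: "norm e = 1" using vector_choose_size[of 1] by auto
  have "\<bar>\<kappa>\<bar> = r"
    using r(3)[of e 0] e by (simp add: eq dist_norm \<kappa>_def)
  with r(1,2) eq show ?thesis
    by (intro that[of \<kappa> "\<chi> j. of_int (a $ j) / of_int (b $ j)"]) (auto simp: \<kappa>_def)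
qed

theorem theorem5p6:
  fixes D :: "'i set"
    and \<phi> :: "'i \<Rightarrow> real ^ 'n \<Rightarrow> real ^ 'n"
    and X :: "(real ^ 'n) set"
  assumes "rational_ifs D \<phi>"
    and "card D \<ge> 2"
    and "open_set_condition D \<phi>"
    and "is_attractor D \<phi> X"
  shows "\<exists>x\<in>X. very_well_approximable x \<and> \<not> liouville x"
proof -
  have "\<not> card D \<le> Suc 0" using assms(2) by simp
  moreover have "finite D" using assms(2) by (metis card.infinite not_numeral_le_zero)
  ultimately obtain i j where ij: "i \<in> D" "j \<in> D" "i \<noteq> j"
    by (metis card_le_Suc0_iff_eq)
  obtain \<kappa> s where f: "\<And>x. \<phi> i x = \<kappa> *\<^sub>R x + s" "0 < \<bar>\<kappa>\<bar>" "\<bar>\<kappa>\<bar> < 1" "\<kappa> \<in> \<rat>" "\<And>l. s $ l \<in> \<rat>"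
    using rational_ifs_map[OF assms(1) ij(1)] by metis
  obtain \<mu> t where g: "\<And>x. \<phi> j x = \<mu> *\<^sub>R x + t" "0 < \<bar>\<mu>\<bar>" "\<bar>\<mu>\<bar> < 1" "\<mu> \<in> \<rat>" "\<And>l. t $ l \<in> \<rat>"
    using rational_ifs_map[OF assms(1) ij(2)] by metis
  obtain U where U: "U \<noteq> {}" "\<phi> i ` U \<subseteq> U" "\<phi> j ` U \<subseteq> U" "\<phi> i ` U \<inter> \<phi> j ` U = {}"
    using assms(3) ij unfolding open_set_condition_def by metis
  have no_common: "\<phi> j z \<noteq> z" if "\<phi> i z = z" for z
    using common_fixpoint_violates_disjointness[OF f(1) g(1) that _ U(2,3,1)] U(4) by blast
  have "X \<noteq> {}" "compact X" "\<phi> i ` X \<subseteq> X" "\<phi> j ` X \<subseteq> X"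
    using assms(4) ij unfolding is_attractor_def by blast+
  then show ?thesis
    using rational_similarity_pair_attractor[OF f(1) g(1) f(2,3) g(2,3) f(4) g(4) f(5) g(5) _ _ _ _ no_common]
    by blast
qed

end
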